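(* Consider the order-assignment model described in the context. Assume $r>cm$ and oversupply, i.e. $N>b$. Let $\alpha\in(0,1)$ with $\alpha N\in\mathbb{N}$, let $\tau\ge r$ be an admissible threshold, and let $\deg:=N/b$. If $$\deg<\frac{1}{1-\alpha}\left(1-\frac{\alpha\,(r+R-cm)}{(1-\alpha)(\tau-cm)+\alpha(r-cm)}\right),$$ then the benefit of participation $B(\alpha,\tau):=u^D(\alpha,\tau)-u^A(\alpha,\tau)$ satisfies $B(\alpha,\tau)>0$.
   Context: Model. Parameters: integers $N\ge1$ (workers) and $b\ge1$ (busy time); reals $r>0$ (base pay), $\delta>0$ (pay increment), $c,m\ge0$ (cost per mile, miles per order), $n>0$ (orders per hour); a threshold $\tau\ge r$ such that $Z:=(\tau-r)/\delta$ is a nonnegative integer (admissible threshold); a fraction $\alpha\in[0,1]$ with $\alpha N$ an integer. Exactly $\alpha N$ of the workers are participants, the other $(1-\alpha)N$ are non-participants. Dynamics. Time is discrete, with one incoming order per time step $t$. Each worker is idle or busy. If at least one worker is idle at step $t$, the order is offered, at pay $r$, to a uniformly random idle worker. A non-participant accepts at any pay; a participant accepts iff the current pay is at least $\tau$ and otherwise declines. After each decline the pay rises by $\delta$ and the order is offered again to an independently, uniformly chosen idle worker (possibly the same one), within the same time step, until accepted. A worker accepting the order of step $t$ is busy for $b$ time steps: unavailable for the orders of steps $t+1,\dots,t+b-1$ and idle again for the order of step $t+b$. If no worker is idle at step $t$, the order of step $t$ is lost. The process starts from an arbitrary fixed initial configuration (every initially busy worker becoming idle within $b$ steps). Let $I_t=1$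 if some worker is idle at step $t$ and $I_t=0$ otherwise. When $I_t=1$, let $q_t$ be the fraction of participants among the workers idle at step $t$ (before assignment), and let $\beta_t:=q_t^{Z+1}$, the conditional probability that a participant accepts the order. For $q_t<1$ let $$R_t:=\sum_{z=0}^{Z} z\delta\,\frac{q_t^z(1-q_t)}{1-q_t^{Z+1}},$$ the expected pay increase over $r$ given that a non-participant accepts; the product $(1-\beta_t)R_t$ is read as $0$ when $q_t=1$. Any product containing the factor $I_t$ is $0$ when $I_t=0$. For a quantity $X_t$ depending on the state at step $t$, $\mathbb{E}_t[X_t]:=\lim_{T\to\infty}\frac1T\sum_{t=1}^T\mathbb{E}[X_t]$ (long-run average). The spillover effect is $R:=\mathbb{E}_t[(1-\beta_t)R_tI_t]$. Utilities (expected hourly income per worker), for participants and non-participants respectively: $$u^D(\alpha,\tau):=\frac{1}{\alpha N}(\tau-cm)\,n\,\mathbb{E}_t[\beta_tI_t]\quad(\alpha>0),$$ $$u^A(\alpha,\tau):=\frac{1}{(1-\alpha)N}(r-cm)\,n\,\mathbb{E}_t[(1-\beta_t)I_t]+\frac{n}{(1-\alpha)N}R\quad(\alpha<1).$$ *)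

theory Defs
  imports "HOL-Probability.Probability"
begin

text \<open>
  Workers are the numbers below \<open>N\<close>, and \<open>P\<close> is the set of participants.  A state assigns to each
  worker the number of further steps for which it stays unavailable, so a worker is idle for the
  order of the current step iff its entry is \<open>0\<close>.
\<close>

type_synonym state = "nat \<Rightarrow> nat"

definition idle :: "nat \<Rightarrow> state \<Rightarrow> nat set" where
  "idle N s = {w. w < N \<and> s w = 0}"

definition accepts :: "real \<Rightarrow> nat set \<Rightarrow> real \<Rightarrow> nat \<Rightarrow> bool" where
  "accepts \<tau> P pay w \<longleftrightarrow> w \<notin> P \<or> pay \<ge> \<tau>"

text \<open>
  The law of the worker who finally accepts an order that is currently offered at \<open>pay\<close> to the
  workers in \<open>A\<close>.  The recursion terminates only for \<open>\<delta> > 0\<close> (or if everybody accepts), hence a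
  partial function; \<open>offer_unfold\<close> below is its defining equation for \<open>\<delta> > 0\<close>.
\<close>

function (domintros) offer :: "real \<Rightarrow> real \<Rightarrow> nat set \<Rightarrow> nat set \<Rightarrow> real \<Rightarrow> nat pmf" where
  "offer \<delta> \<tau> P A pay =
     bind_pmf (pmf_of_set A)
       (\<lambda>w. if accepts \<tau> P pay w then return_pmf w else offer \<delta> \<tau> P A (pay + \<delta>))"
  by pat_completeness auto

lemma offer_dom:
  assumes "\<delta> > 0"
  shows "offer_dom (\<delta>, \<tau>, P, A, pay)"
proof (induction "nat \<lceil>(\<tau> - pay) / \<delta>\<rceil>" arbitrary: pay rule: less_induct)
  case less
  show ?case
  proof (rule offer.domintros)
    fix w assume "\<not> accepts \<tau> P pay w"
    then have "pay < \<tau>" by (simp add: accepts_def)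
    then have pos: "(\<tau> - pay) / \<delta> > 0" using assms by simp
    have "(\<tau> - (pay + \<delta>)) / \<delta> = (\<tau> - pay) / \<delta> - 1"
      using assms by (simp add: field_simps)
    then have "nat \<lceil>(\<tau> - (pay + \<delta>)) / \<delta>\<rceil> < nat \<lceil>(\<tau> - pay) / \<delta>\<rceil>"
      using pos by simp
    then show "offer_dom (\<delta>, \<tau>, P, A, pay + \<delta>)" by (rule less)
  qed
qed

lemma offer_unfold:
  assumes "\<delta> > 0"
  shows "offer \<delta> \<tau> P A pay =
     bind_pmf (pmf_of_set A)
       (\<lambda>w. if accepts \<tau> P pay w then return_pmf w else offer \<delta> \<tau> P A (pay + \<delta>))"
  by (rule offer.psimps[OF offer_dom[OF assms]])

text \<open>
  A worker accepting at step \<open>t\<close> gets the entry \<open>b - 1\<close> in the state at step \<open>t + 1\<close>, so that it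
  misses exactly the orders of steps \<open>t + 1, \<dots>, t + b - 1\<close>.  If nobody is idle, the order is lost.
\<close>

definition step ::
  "nat \<Rightarrow> nat \<Rightarrow> real \<Rightarrow> real \<Rightarrow> nat set \<Rightarrow> real \<Rightarrow> state \<Rightarrow> state pmf" where
  "step N b r \<delta> P \<tau> s =
     (if idle N s = {} then return_pmf (\<lambda>v. s v - 1)
      else map_pmf (\<lambda>w. (\<lambda>v. s v - 1)(w := b - 1)) (offer \<delta> \<tau> P (idle N s) r))"

text \<open>The law of the state at step \<open>t \<ge> 1\<close>; the initial configuration is the state at step \<open>1\<close>.\<close>

definition state_at ::
  "nat \<Rightarrow> nat \<Rightarrow> real \<Rightarrow> real \<Rightarrow> nat set \<Rightarrow> real \<Rightarrow> state \<Rightarrow> nat \<Rightarrow> state pmf" where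
  "state_at N b r \<delta> P \<tau> s0 t =
     ((\<lambda>p. bind_pmf p (step N b r \<delta> P \<tau>)) ^^ (t - 1)) (return_pmf s0)"

definition long_run_average ::
  "nat \<Rightarrow> nat \<Rightarrow> real \<Rightarrow> real \<Rightarrow> nat set \<Rightarrow> real \<Rightarrow> state \<Rightarrow> (state \<Rightarrow> real) \<Rightarrow> real" where
  "long_run_average N b r \<delta> P \<tau> s0 X =
     lim (\<lambda>T. (\<Sum>t=1..T. measure_pmf.expectation (state_at N b r \<delta> P \<tau> s0 t) X) / real T)"

definition some_idle :: "nat \<Rightarrow> state \<Rightarrow> real" where
  "some_idle N s = (if idle N s \<noteq> {} then 1 else 0)"

definition participant_fraction :: "nat \<Rightarrow> nat set \<Rightarrow> state \<Rightarrow> real" where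
  "participant_fraction N P s = real (card (idle N s \<inter> P)) / real (card (idle N s))"

text \<open>The number \<open>Z\<close> of raises from \<open>r\<close> to \<open>\<tau>\<close>; the floor is exact for admissible thresholds.\<close>

definition num_raises :: "real \<Rightarrow> real \<Rightarrow> real \<Rightarrow> nat" where
  "num_raises r \<delta> \<tau> = nat \<lfloor>(\<tau> - r) / \<delta>\<rfloor>"

definition accept_prob :: "nat \<Rightarrow> real \<Rightarrow> real \<Rightarrow> nat set \<Rightarrow> real \<Rightarrow> state \<Rightarrow> real" where
  "accept_prob N r \<delta> P \<tau> s = participant_fraction N P s ^ (num_raises r \<delta> \<tau> + 1)"

text \<open>
  If only participants are idle, the denominators below vanish and the value is \<open>0\<close>; it is only used
  multiplied by \<open>1 - accept_prob N r \<delta> P \<tau> s\<close>, which is then \<open>0\<close> as well.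
\<close>

definition expected_increase :: "nat \<Rightarrow> real \<Rightarrow> real \<Rightarrow> nat set \<Rightarrow> real \<Rightarrow> state \<Rightarrow> real" where
  "expected_increase N r \<delta> P \<tau> s =
     (let q = participant_fraction N P s; Z = num_raises r \<delta> \<tau>
      in \<Sum>z=0..Z. real z * \<delta> * (q ^ z * (1 - q) / (1 - q ^ (Z + 1))))"

definition spillover ::
  "nat \<Rightarrow> nat \<Rightarrow> real \<Rightarrow> real \<Rightarrow> nat set \<Rightarrow> real \<Rightarrow> state \<Rightarrow> real" where
  "spillover N b r \<delta> P \<tau> s0 =
     long_run_average N b r \<delta> P \<tau> s0
       (\<lambda>s. (1 - accept_prob N r \<delta> P \<tau> s) * expected_increase N r \<delta> P \<tau> s * some_idle N s)"

text \<open>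
  In the utilities, \<open>\<alpha>\<close> is meant to be the fraction of participants: \<open>card P = \<alpha> N\<close>.
\<close>

definition utility_participant ::
  "nat \<Rightarrow> nat \<Rightarrow> real \<Rightarrow> real \<Rightarrow> real \<Rightarrow> real \<Rightarrow> real \<Rightarrow> nat set \<Rightarrow> state \<Rightarrow> real \<Rightarrow> real \<Rightarrow> real" where
  "utility_participant N b r \<delta> c m n P s0 \<alpha> \<tau> =
     1 / (\<alpha> * real N) * (\<tau> - c * m) * n *
     long_run_average N b r \<delta> P \<tau> s0 (\<lambda>s. accept_prob N r \<delta> P \<tau> s * some_idle N s)"

definition utility_nonparticipant ::
  "nat \<Rightarrow> nat \<Rightarrow> real \<Rightarrow> real \<Rightarrow> real \<Rightarrow> real \<Rightarrow> real \<Rightarrow> nat set \<Rightarrow> state \<Rightarrow> real \<Rightarrow> real \<Rightarrow> real" where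
  "utility_nonparticipant N b r \<delta> c m n P s0 \<alpha> \<tau> =
     1 / ((1 - \<alpha>) * real N) * (r - c * m) * n *
     long_run_average N b r \<delta> P \<tau> s0 (\<lambda>s. (1 - accept_prob N r \<delta> P \<tau> s) * some_idle N s)
     + n / ((1 - \<alpha>) * real N) * spillover N b r \<delta> P \<tau> s0"

definition benefit ::
  "nat \<Rightarrow> nat \<Rightarrow> real \<Rightarrow> real \<Rightarrow> real \<Rightarrow> real \<Rightarrow> real \<Rightarrow> nat set \<Rightarrow> state \<Rightarrow> real \<Rightarrow> real \<Rightarrow> real" where
  "benefit N b r \<delta> c m n P s0 \<alpha> \<tau> =
     utility_participant N b r \<delta> c m n P s0 \<alpha> \<tau> -
     utility_nonparticipant N b r \<delta> c m n P s0 \<alpha> \<tau>"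

end

(* Let x and y be the long-run fractions of the orders accepted by participants and by
   non-participants; they exist because the clipped state process is a finite Markov chain, whose
   time averages converge.  Since N > b, after b steps somebody is always idle, so x + y = 1.  An
   order keeps its worker unavailable for b steps, so the (1 - \<alpha>) N non-participants accept at most
   a fraction y <= (1 - \<alpha>) N / b.  B > 0 means
   y ((1 - \<alpha>) (\<tau> - c m) + \<alpha> (r - c m)) < (1 - \<alpha>) (\<tau> - c m) - \<alpha> R,
   and this is the assumed bound on N / b applied to y. *)

theory Submission
  imports Defs "HOL-Complex_Analysis.Great_Picard"
begin

section \<open>Finite Markov chains: convergence of time averages and a drift bound\<close>

locale finite_markov_chain =
  fixes S :: "'a set" and K :: "'a \<Rightarrow> 'a pmf"
  assumes finite_states: "finite S"
    and closed: "x \<in> S \<Longrightarrow> set_pmf (K x) \<subseteq> S"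
begin

text \<open>The transition operator on functions, as a finite sum over \<open>S\<close> so that
  linearity needs no integrability. Only at points of \<open>S\<close>, where \<open>closed\<close>
  applies, is it known to be the expectation under \<open>K\<close>.\<close>

definition markov_op :: "('a \<Rightarrow> real) \<Rightarrow> 'a \<Rightarrow> real" where
  "markov_op f x = (\<Sum>y\<in>S. pmf (K x) y * f y)"

lemma expectation_eq_markov_op:
  assumes "x \<in> S"
  shows "measure_pmf.expectation (K x) f = markov_op f x"
  using closed[OF assms] finite_states
  by (subst integral_measure_pmf_real[of S]) (auto simp: markov_op_def mult.commute)

lemma markov_op_bound:
  assumes "\<And>y. y \<in> S \<Longrightarrow> \<bar>f y\<bar> \<le> M" and "x \<in> S"
  shows "\<bar>markov_op f x\<bar> \<le> M"
proof -
  have "\<bar>markov_op f x\<bar> \<le> (\<Sum>y\<in>S. \<bar>pmf (K x) y * f y\<bar>)"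
    unfolding markov_op_def by (rule sum_abs)
  also have "\<dots> \<le> (\<Sum>y\<in>S. pmf (K x) y * M)"
    using assms by (intro sum_mono) (auto simp: abs_mult intro!: mult_left_mono)
  also have "\<dots> = M"
    using closed[OF \<open>x \<in> S\<close>] finite_states by (simp add: sum_distrib_right[symmetric] sum_pmf_eq_1)
  finally show ?thesis .
qed

lemma markov_op_funpow_bound:
  assumes "\<And>y. y \<in> S \<Longrightarrow> \<bar>f y\<bar> \<le> M" and "x \<in> S"
  shows "\<bar>(markov_op ^^ t) f x\<bar> \<le> M"
  using \<open>x \<in> S\<close>
proof (induction t arbitrary: x)
  case (Suc t)
  show ?case using markov_op_bound[of "(markov_op ^^ t) f" M, OF Suc.IH Suc.prems] by simp
qed (simp add: assms(1))

lemma markov_op_cong: "(\<And>y. y \<in> S \<Longrightarrow> f y = g y) \<Longrightarrow> markov_op f x = markov_op g x"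
  by (simp add: markov_op_def)

lemma markov_op_diff: "markov_op (\<lambda>x. f x - g x) = (\<lambda>x. markov_op f x - markov_op g x)"
  by (simp add: markov_op_def right_diff_distrib sum_subtractf fun_eq_iff)

lemma markov_op_sum:
  "markov_op (\<lambda>x. \<Sum>i\<in>I. f i x) = (\<lambda>x. \<Sum>i\<in>I. markov_op (f i) x)"
  unfolding markov_op_def fun_eq_iff sum_distrib_left by (auto intro: sum.swap)

lemma markov_op_divide: "markov_op (\<lambda>x. f x / a) = (\<lambda>x. markov_op f x / a)"
  by (simp add: markov_op_def sum_divide_distrib fun_eq_iff)

lemma markov_op_funpow_diff:
  "(markov_op ^^ t) (\<lambda>x. f x - g x) = (\<lambda>x. (markov_op ^^ t) f x - (markov_op ^^ t) g x)"
  by (induction t) (simp_all add: markov_op_diff)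

definition cesaro :: "nat \<Rightarrow> ('a \<Rightarrow> real) \<Rightarrow> 'a \<Rightarrow> real" where
  "cesaro T f x = (\<Sum>t<T. (markov_op ^^ t) f x) / real T"

lemma cesaro_diff: "cesaro T (\<lambda>x. f x - g x) x = cesaro T f x - cesaro T g x"
  by (simp add: cesaro_def markov_op_funpow_diff sum_subtractf diff_divide_distrib)

lemma cesaro_bound:
  assumes "\<And>y. y \<in> S \<Longrightarrow> \<bar>f y\<bar> \<le> M" and "x \<in> S"
  shows "\<bar>cesaro T f x\<bar> \<le> M"
proof (cases "T = 0")
  case True
  then show ?thesis using assms(1)[OF assms(2)] by (simp add: cesaro_def)
next
  case False
  have "\<bar>\<Sum>t<T. (markov_op ^^ t) f x\<bar> \<le> (\<Sum>t<T. \<bar>(markov_op ^^ t) f x\<bar>)" by (rule sum_abs)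
  also have "\<dots> \<le> (\<Sum>t<T. M)"
    by (intro sum_mono markov_op_funpow_bound[OF assms])
  finally show ?thesis using False by (simp add: cesaro_def field_simps)
qed

text \<open>The sum over \<open>t\<close> telescopes; for \<open>T = 0\<close> both sides are
  \<open>0\<close> because division by zero gives \<open>0\<close>.\<close>

lemma cesaro_coboundary:
  "cesaro T (\<lambda>x. h x - markov_op h x) x = (h x - (markov_op ^^ T) h x) / real T"
proof -
  have "(\<Sum>t<T. (markov_op ^^ t) h x - (markov_op ^^ t) (markov_op h) x)
      = h x - (markov_op ^^ T) h x"
    by (induction T) (simp_all add: funpow_swap1)
  then show ?thesis by (simp add: cesaro_def markov_op_funpow_diff)
qed

text \<open>Iterating \<open>markov_op\<close> preserves a bound \<open>M\<close> on
  \<open>S\<close>, so the telescoped numerator stays within \<open>2 * M\<close> while the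
  denominator grows.\<close>

lemma cesaro_coboundary_tendsto_0:
  assumes "x \<in> S"
  shows "(\<lambda>T. cesaro T (\<lambda>x. h x - markov_op h x) x) \<longlonglongrightarrow> 0"
proof -
  define M where "M = (\<Sum>y\<in>S. \<bar>h y\<bar>)"
  have M: "\<bar>h y\<bar> \<le> M" if "y \<in> S" for y
    unfolding M_def using finite_states that by (intro member_le_sum) auto
  have "\<bar>(h x - (markov_op ^^ T) h x) / real T\<bar> \<le> 2 * M / real T" for T
  proof -
    have "\<bar>h x - (markov_op ^^ T) h x\<bar> \<le> 2 * M"
      using M[OF assms] markov_op_funpow_bound[of h M x T, OF M assms] by linarith
    then show ?thesis by (simp add: abs_divide divide_right_mono)
  qed
  then have "\<forall>\<^sub>F T in sequentially. norm ((h x - (markov_op ^^ T) h x) / real T) \<le> 2 * M / real T"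
    by (intro always_eventually allI) (simp only: real_norm_def)
  from Lim_null_comparison[OF this lim_const_over_n] show ?thesis
    unfolding cesaro_coboundary .
qed

text \<open>Each \<open>f - (markov_op ^^ t) f\<close> is the coboundary of the partial sum of the
  iterates below \<open>t\<close>; \<open>h\<close> averages these partial sums over
  \<open>t < T\<close>.\<close>

lemma minus_cesaro_is_coboundary:
  assumes "T > 0"
  shows "\<exists>h. \<forall>x. f x - cesaro T f x = h x - markov_op h x"
proof -
  define h where "h = (\<lambda>x. (\<Sum>t<T. \<Sum>i<t. (markov_op ^^ i) f x) / real T)"
  have "(\<Sum>i<t. (markov_op ^^ i) f x - markov_op ((markov_op ^^ i) f) x) = f x - (markov_op ^^ t) f x"
    for t x by (induction t) auto
  then have "h x - markov_op h x = (\<Sum>t<T. f x - (markov_op ^^ t) f x) / real T" for x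
    by (simp add: h_def markov_op_divide markov_op_sum diff_divide_distrib[symmetric]
        sum_subtractf[symmetric])
  then have "f x - cesaro T f x = h x - markov_op h x" for x
    using assms by (simp add: sum_subtractf cesaro_def diff_divide_distrib)
  then show ?thesis by blast
qed

text \<open>
  Yosida's argument: a subsequential limit \<open>g\<close> of the averages is invariant, and \<open>f - g\<close> is a limit of
  coboundaries, whose averages tend to \<open>0\<close>; so the whole sequence converges to \<open>g\<close>.
\<close>

theorem cesaro_convergent:
  assumes x: "x \<in> S"
  shows "convergent (\<lambda>T. cesaro T f x)"
proof -
  define M where "M = (\<Sum>y\<in>S. \<bar>f y\<bar>)"
  have M: "\<bar>f y\<bar> \<le> M" if "y \<in> S" for y
    unfolding M_def using finite_states that by (intro member_le_sum) auto
  obtain \<sigma> :: "nat \<Rightarrow> nat" where \<sigma>: "strict_mono \<sigma>"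
    and "\<And>y. y \<in> S \<Longrightarrow> \<exists>l. (\<lambda>j. cesaro (\<sigma> j) f y) \<longlonglongrightarrow> l"
    using function_convergent_subsequence[of S "\<lambda>T. cesaro T f" M]
      cesaro_bound[OF M] finite_states by (auto simp: countable_finite)
  then obtain g where g: "(\<lambda>j. cesaro (\<sigma> j) f y) \<longlonglongrightarrow> g y" if "y \<in> S" for y by metis
  have inv: "markov_op g y = g y" if "y \<in> S" for y
  proof -
    have "(\<lambda>j. markov_op (cesaro (\<sigma> j) f) y) \<longlonglongrightarrow> markov_op g y"
      unfolding markov_op_def[of _ y] by (intro tendsto_intros g)
    \<comment> \<open>Since \<open>markov_op\<close> commutes with taking averages, this difference
      is the average of the coboundary of \<open>f\<close> itself.\<close>
    moreover have "(\<lambda>T. cesaro T f y - markov_op (cesaro T f) y) \<longlonglongrightarrow> 0"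
    proof -
      have "markov_op (cesaro T f) y = cesaro T (markov_op f) y" for T
        unfolding cesaro_def markov_op_divide markov_op_sum by (simp add: funpow_swap1)
      then show ?thesis
        using cesaro_coboundary_tendsto_0[OF that, of f] by (simp add: cesaro_diff)
    qed
    from LIMSEQ_subseq_LIMSEQ[OF this \<sigma>]
    have "(\<lambda>j. cesaro (\<sigma> j) f y - markov_op (cesaro (\<sigma> j) f) y) \<longlonglongrightarrow> 0" by (simp add: comp_def)
    ultimately have "g y - markov_op g y = 0"
      using tendsto_diff[OF g[OF that]] LIMSEQ_unique by blast
    then show ?thesis by simp
  qed
  have "(markov_op ^^ t) g y = g y" if "y \<in> S" for t y
    using that
  proof (induction t arbitrary: y)
    case (Suc t)
    then show ?case using markov_op_cong[of "(markov_op ^^ t) g" g y] inv by simp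
  qed auto
  then have cg: "cesaro T g x = g x" if "T > 0" for T using x that by (simp add: cesaro_def)
  have "(\<lambda>T. cesaro T f x) \<longlonglongrightarrow> g x"
  proof (rule LIMSEQ_I)
    fix e :: real assume "e > 0"
    have "\<forall>\<^sub>F j in sequentially. \<forall>y\<in>S. dist (cesaro (\<sigma> j) f y) (g y) < e / 2"
      using g \<open>e > 0\<close> by (intro eventually_ball_finite finite_states ballI tendstoD) auto
    then obtain j0 where j0: "\<And>j y. j \<ge> j0 \<Longrightarrow> y \<in> S \<Longrightarrow> \<bar>cesaro (\<sigma> j) f y - g y\<bar> < e / 2"
      unfolding dist_real_def eventually_sequentially by blast
    \<comment> \<open>The successor makes \<open>\<sigma> j\<close> positive, which the coboundary
      representation requires.\<close>
    define j where "j = Suc j0"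
    have "\<sigma> j > 0" using seq_suble[OF \<sigma>, of j] by (simp add: j_def)
    then obtain h where h: "\<And>y. f y - cesaro (\<sigma> j) f y = h y - markov_op h y"
      using minus_cesaro_is_coboundary by metis
    have "\<forall>\<^sub>F T in sequentially. dist (cesaro T (\<lambda>x. h x - markov_op h x) x) 0 < e / 2"
      using cesaro_coboundary_tendsto_0[OF x] \<open>e > 0\<close> by (intro tendstoD) auto
    then obtain T0 where T0: "\<And>T. T \<ge> T0 \<Longrightarrow> \<bar>cesaro T (\<lambda>x. h x - markov_op h x) x\<bar> < e / 2"
      unfolding eventually_sequentially by auto
    show "\<exists>T0. \<forall>T\<ge>T0. norm (cesaro T f x - g x) < e"
    proof (intro exI allI impI)
      fix T assume "Suc T0 \<le> T"
      then have T: "T \<ge> T0" "T > 0" by auto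
      \<comment> \<open>A coboundary, whose averages vanish in the limit, minus an error that is
        below \<open>e / 2\<close> on all of \<open>S\<close> and hence at most \<open>e / 2\<close>
        on average.\<close>
      have eq: "(\<lambda>y. f y - g y) = (\<lambda>y. (h y - markov_op h y) - (g y - cesaro (\<sigma> j) f y))"
        using h by (simp add: fun_eq_iff algebra_simps)
      have "cesaro T f x - g x = cesaro T (\<lambda>y. f y - g y) x"
        using cg[OF T(2)] by (simp add: cesaro_diff)
      also have "\<dots> = cesaro T (\<lambda>y. h y - markov_op h y) x - cesaro T (\<lambda>y. g y - cesaro (\<sigma> j) f y) x"
        unfolding eq by (rule cesaro_diff)
      finally have "\<bar>cesaro T f x - g x\<bar> \<le> \<bar>cesaro T (\<lambda>y. h y - markov_op h y) x\<bar>
          + \<bar>cesaro T (\<lambda>y. g y - cesaro (\<sigma> j) f y) x\<bar>" by linarith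
      moreover have "\<bar>cesaro T (\<lambda>y. g y - cesaro (\<sigma> j) f y) x\<bar> \<le> e / 2"
        using j0[of j] by (intro cesaro_bound[OF _ x])
          (auto simp: abs_minus_commute j_def intro: less_imp_le)
      ultimately show "norm (cesaro T f x - g x) < e" using T0[OF T(1)] by simp
    qed
  qed
  then show ?thesis by (rule convergentI)
qed

text \<open>Time starts at \<open>0\<close> here, but at \<open>1\<close> in
  \<open>state_at\<close>.\<close>

definition law :: "'a \<Rightarrow> nat \<Rightarrow> 'a pmf" where
  "law x t = ((\<lambda>p. bind_pmf p K) ^^ t) (return_pmf x)"

lemma law_0: "law x 0 = return_pmf x"
  by (simp add: law_def)

lemma law_Suc: "law x (Suc t) = bind_pmf (law x t) K"
  by (simp add: law_def)

lemma set_pmf_law: "x \<in> S \<Longrightarrow> set_pmf (law x t) \<subseteq> S"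
  by (induction t) (use closed in \<open>auto simp: law_0 law_Suc\<close>)

lemma integrable_law: "x \<in> S \<Longrightarrow> integrable (measure_pmf (law x t)) (f :: 'a \<Rightarrow> real)"
  by (meson finite_states finite_subset integrable_measure_pmf_finite set_pmf_law)

lemma expectation_law_Suc:
  assumes "x \<in> S"
  shows "measure_pmf.expectation (law x (Suc t)) f = measure_pmf.expectation (law x t) (markov_op f)"
proof -
  have "measure_pmf.expectation (law x (Suc t)) f
      = (\<Sum>a\<in>S. pmf (law x t) a *\<^sub>R measure_pmf.expectation (K a) f)"
    unfolding law_Suc using set_pmf_law[OF assms]
    by (intro pmf_expectation_bind finite_states) (auto intro: finite_subset[OF closed finite_states])
  also have "\<dots> = measure_pmf.expectation (law x t) (markov_op f)"
    using set_pmf_law[OF assms]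
    by (subst integral_measure_pmf_real[of S])
      (auto simp: expectation_eq_markov_op finite_states mult.commute)
  finally show ?thesis .
qed

lemma expectation_law:
  assumes "x \<in> S"
  shows "measure_pmf.expectation (law x t) f = (markov_op ^^ t) f x"
proof (induction t arbitrary: f)
  case (Suc t)
  then show ?case by (simp add: expectation_law_Suc[OF assms] funpow_swap1)
qed (simp add: law_0)

lemma convergent_average_law:
  assumes "x \<in> S"
  shows "convergent (\<lambda>T. (\<Sum>t<T. measure_pmf.expectation (law x t) f) / real T)"
  using cesaro_convergent[OF assms, of f] by (simp add: cesaro_def expectation_law[OF assms])

text \<open>A Lyapunov argument: in expectation the drift inequality telescopes over time, and the
  bounds on the potential \<open>\<Phi>\<close> leave a boundary term of at most
  \<open>C\<close>.\<close>

lemma average_law_le_of_drift: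
  assumes x: "x \<in> S"
    and drift: "\<And>y. y \<in> S \<Longrightarrow> \<Phi> y + a * f y \<le> markov_op \<Phi> y + d"
    and bound: "\<And>y. y \<in> S \<Longrightarrow> 0 \<le> \<Phi> y \<and> \<Phi> y \<le> C"
  shows "a * (\<Sum>t<T. measure_pmf.expectation (law x t) f) \<le> d * real T + C"
proof -
  let ?E = "\<lambda>t f. measure_pmf.expectation (law x t) f"
  have E: "?E t g \<le> ?E t h" if "\<And>y. y \<in> S \<Longrightarrow> g y \<le> h y" for t and g h :: "'a \<Rightarrow> real"
    by (rule integral_mono_AE[OF integrable_law[OF x] integrable_law[OF x]])
      (use set_pmf_law[OF x] that in \<open>auto simp: AE_measure_pmf_iff\<close>)
  have "?E t \<Phi> + a * ?E t f \<le> ?E (Suc t) \<Phi> + d" for t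
    using E[of "\<lambda>y. \<Phi> y + a * f y" "\<lambda>y. markov_op \<Phi> y + d" t] drift
    by (simp add: expectation_law_Suc[OF x] integrable_law[OF x])
  then have "?E 0 \<Phi> + a * (\<Sum>t<T. ?E t f) \<le> ?E T \<Phi> + d * real T"
  proof (induction T)
    case (Suc T)
    from Suc.IH[OF Suc.prems] Suc.prems[of T] show ?case by (simp add: algebra_simps)
  qed simp
  moreover have "0 \<le> ?E 0 \<Phi>" using bound x by (simp add: law_0)
  moreover have "?E T \<Phi> \<le> C" using E[of \<Phi> "\<lambda>_. C" T] bound by simp
  ultimately show ?thesis by linarith
qed

end

section \<open>The law of the worker who accepts an order\<close>

lemma set_pmf_offer:
  assumes "\<delta> > 0" "finite A" "A \<noteq> {}"
  shows "set_pmf (offer \<delta> \<tau> P A pay) \<subseteq> A"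
  using offer_dom[OF assms(1), of \<tau> P A pay] assms
proof (induction \<delta> \<tau> P A pay rule: offer.pinduct)
  case (1 \<delta> \<tau> P A pay)
  then have "set_pmf (if accepts \<tau> P pay w then return_pmf w else offer \<delta> \<tau> P A (pay + \<delta>)) \<subseteq> A"
    if "w \<in> A" for w
    using that by (simp add: set_pmf_of_set)
  then show ?case
    unfolding offer_unfold[OF \<open>\<delta> > 0\<close>, of \<tau> P A pay] set_bind_pmf
    using \<open>finite A\<close> \<open>A \<noteq> {}\<close> by (intro UN_least) (simp add: set_pmf_of_set)
qed

text \<open>A participant gets the order iff all of the \<open>k + 1\<close> offers up to pay \<open>\<tau>\<close> go to participants.\<close>

lemma prob_offer_participant:
  assumes "\<delta> > 0" "finite A" "A \<noteq> {}"
  shows "measure_pmf.prob (offer \<delta> \<tau> P A (\<tau> - real k * \<delta>)) P =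
    (real (card (A \<inter> P)) / real (card A)) ^ (k + 1)"
\<comment> \<open>The induction goes down from pay \<open>\<tau>\<close>, where everybody accepts.
  Each additional lower offer is declined by participants only, so it contributes one more factor
  \<open>q\<close>.\<close>
proof (induction k)
  case 0
  have "offer \<delta> \<tau> P A (\<tau> - real 0 * \<delta>) = pmf_of_set A"
    by (subst offer_unfold[OF assms(1)]) (simp add: accepts_def bind_return_pmf')
  then show ?case using assms by (simp add: measure_pmf_of_set)
next
  case (Suc k)
  let ?q = "real (card (A \<inter> P)) / real (card A)"
  have next_pay: "\<tau> - real (Suc k) * \<delta> + \<delta> = \<tau> - real k * \<delta>" by (simp add: algebra_simps)
  have "\<not> \<tau> \<le> \<tau> - real (Suc k) * \<delta>" using assms(1) by (simp add: add_pos_nonneg not_le)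
  then have "offer \<delta> \<tau> P A (\<tau> - real (Suc k) * \<delta>) = bind_pmf (pmf_of_set A)
      (\<lambda>w. if w \<in> P then offer \<delta> \<tau> P A (\<tau> - real k * \<delta>) else return_pmf w)" (is "_ = ?B")
    unfolding next_pay[symmetric]
    by (subst offer_unfold[OF assms(1)]) (auto simp: accepts_def intro!: bind_pmf_cong)
  then have "measure_pmf.prob (offer \<delta> \<tau> P A (\<tau> - real (Suc k) * \<delta>)) P
      = measure_pmf.expectation ?B (indicator P)"
    by simp
  also have "\<dots> = (\<Sum>w\<in>A. measure_pmf.prob
      (if w \<in> P then offer \<delta> \<tau> P A (\<tau> - real k * \<delta>) else return_pmf w) P / real (card A))"
    using assms finite_subset[OF set_pmf_offer[OF assms]]
    by (subst pmf_expectation_bind_pmf_of_set) (auto simp: divide_inverse mult.commute)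
  also have "\<dots> = (\<Sum>w\<in>A. (if w \<in> P then ?q ^ (k + 1) else 0) / real (card A))"
    by (intro sum.cong) (auto simp: Suc)
  also have "\<dots> = ?q ^ (Suc k + 1)"
    using assms by (simp add: sum.If_cases sum_divide_distrib[symmetric])
  finally show ?case .
qed

section \<open>Reduction to a finite state space\<close>

text \<open>
  The entries of a state from \<open>N\<close> on are irrelevant but unbounded; clipping them makes the state space
  finite.
\<close>

definition clip :: "nat \<Rightarrow> state \<Rightarrow> state" where
  "clip N s = (\<lambda>w. if w < N then s w else 0)"

text \<open>The bound is \<open>b\<close>, although a step leaves entries of at most
  \<open>b - 1\<close>, because the initial configuration may contain \<open>b\<close>.\<close>

definition clipped_states :: "nat \<Rightarrow> nat \<Rightarrow> state set" where
  "clipped_states N b = {s. (\<forall>w<N. s w \<le> b) \<and> (\<forall>w\<ge>N. s w = 0)}"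

lemma idle_clip: "idle N (clip N s) = idle N s"
  by (auto simp: idle_def clip_def)

lemma finite_idle: "finite (idle N s)"
  by (simp add: idle_def)

lemma clip_in_clipped_states: "\<forall>w<N. s w \<le> b \<Longrightarrow> clip N s \<in> clipped_states N b"
  by (simp add: clip_def clipped_states_def)

lemma set_pmf_step:
  assumes "\<delta> > 0" "s' \<in> set_pmf (step N b r \<delta> P \<tau> s)"
  shows "(idle N s = {} \<and> s' = (\<lambda>v. s v - 1)) \<or>
    (\<exists>w\<in>idle N s. s' = (\<lambda>v. s v - 1)(w := b - 1))"
  using assms set_pmf_offer[OF assms(1) finite_idle, of N s \<tau> P r]
  by (auto simp: step_def split: if_splits)

text \<open>Idleness depends only on entries below \<open>N\<close>, and the accepting worker is
  itself below \<open>N\<close>, so its new entry survives clipping.\<close>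

lemma step_clip:
  assumes "\<delta> > 0"
  shows "step N b r \<delta> P \<tau> (clip N s) = map_pmf (clip N) (step N b r \<delta> P \<tau> s)"
proof (cases "idle N s = {}")
  case True
  have "(\<lambda>v. clip N s v - 1) = clip N (\<lambda>v. s v - 1)"
    by (simp add: clip_def fun_eq_iff)
  with True show ?thesis by (simp add: step_def idle_clip)
next
  case False
  have "(\<lambda>v. clip N s v - 1)(w := b - 1) = clip N ((\<lambda>v. s v - 1)(w := b - 1))"
    if "w \<in> set_pmf (offer \<delta> \<tau> P (idle N s) r)" for w
    using set_pmf_offer[OF assms finite_idle False] that
    by (auto simp: clip_def idle_def fun_eq_iff)
  then have "map_pmf (\<lambda>w. (\<lambda>v. clip N s v - 1)(w := b - 1)) (offer \<delta> \<tau> P (idle N s) r)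
      = map_pmf (\<lambda>w. clip N ((\<lambda>v. s v - 1)(w := b - 1))) (offer \<delta> \<tau> P (idle N s) r)"
    by (intro map_pmf_cong) auto
  with False show ?thesis
    by (simp add: step_def idle_clip map_pmf_comp)
qed

lemma state_at_clip:
  assumes "\<delta> > 0"
  shows "state_at N b r \<delta> P \<tau> (clip N s) t = map_pmf (clip N) (state_at N b r \<delta> P \<tau> s t)"
proof -
  let ?K = "step N b r \<delta> P \<tau>"
  have "((\<lambda>p. bind_pmf p ?K) ^^ k) (return_pmf (clip N s))
      = map_pmf (clip N) (((\<lambda>p. bind_pmf p ?K) ^^ k) (return_pmf s))" for k
    by (induction k) (simp_all add: bind_map_pmf map_bind_pmf step_clip[OF assms])
  then show ?thesis by (simp add: state_at_def)
qed

lemma finite_markov_chain_step: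
  assumes "\<delta> > 0"
  shows "finite_markov_chain (clipped_states N b) (step N b r \<delta> P \<tau>)"
proof
  have "clipped_states N b \<subseteq> {s. \<forall>w. (w \<in> {..<N} \<longrightarrow> s w \<in> {..b}) \<and> (w \<notin> {..<N} \<longrightarrow> s w = 0)}"
    unfolding clipped_states_def by (intro Collect_mono) (simp add: not_less)
  then show "finite (clipped_states N b)"
    by (rule finite_subset) (intro finite_set_of_finite_funs finite_lessThan finite_atMost)
next
  fix s assume s: "s \<in> clipped_states N b"
  show "set_pmf (step N b r \<delta> P \<tau> s) \<subseteq> clipped_states N b"
  proof
    fix s' assume "s' \<in> set_pmf (step N b r \<delta> P \<tau> s)"
    moreover have "s w - 1 \<le> b" if "w < N" for w
      using s that le_trans[OF diff_le_self, of "s w" b 1] by (simp add: clipped_states_def)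
    ultimately show "s' \<in> clipped_states N b"
      using set_pmf_step[OF assms, of s' N b r P \<tau> s] s
      by (auto simp: clipped_states_def idle_def)
  qed
qed

abbreviation state_law ::
  "nat \<Rightarrow> nat \<Rightarrow> real \<Rightarrow> real \<Rightarrow> nat set \<Rightarrow> real \<Rightarrow> state \<Rightarrow> nat \<Rightarrow> state pmf" where
  "state_law N b r \<delta> P \<tau> s t \<equiv> finite_markov_chain.law (step N b r \<delta> P \<tau>) s t"

text \<open>\<open>long_run_average\<close> is a bare \<open>lim\<close>, which is informative only
  once convergence is known. Convergence comes from the finite clipped chain, which \<open>X\<close>
  cannot tell from the original one.\<close>

lemma long_run_average_tendsto:
  assumes "\<delta> > 0" and "\<forall>w<N. s0 w \<le> b" and X: "\<And>s. X (clip N s) = X s"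
  shows "(\<lambda>T. (\<Sum>t<T. measure_pmf.expectation (state_law N b r \<delta> P \<tau> (clip N s0) t) X) / real T)
    \<longlonglongrightarrow> long_run_average N b r \<delta> P \<tau> s0 X"
proof -
  interpret finite_markov_chain "clipped_states N b" "step N b r \<delta> P \<tau>"
    by (rule finite_markov_chain_step[OF assms(1)])
  have "measure_pmf.expectation (state_at N b r \<delta> P \<tau> s0 (Suc t)) X
      = measure_pmf.expectation (law (clip N s0) t) X" for t
  proof -
    have "law (clip N s0) t = state_at N b r \<delta> P \<tau> (clip N s0) (Suc t)"
      by (simp add: law_def state_at_def)
    then show ?thesis by (simp add: state_at_clip[OF assms(1)] X)
  qed
  then have "long_run_average N b r \<delta> P \<tau> s0 X
      = lim (\<lambda>T. (\<Sum>t<T. measure_pmf.expectation (law (clip N s0) t) X) / real T)"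
    by (simp add: long_run_average_def sum.atLeast1_atMost_eq)
  then show ?thesis
    using convergent_average_law[OF clip_in_clipped_states[OF assms(2)], of X]
    by (simp add: convergent_LIMSEQ_iff)
qed

section \<open>Acceptances by non-participants against their remaining work\<close>

lemma some_idle_clip: "some_idle N (clip N s) = some_idle N s"
  by (simp add: some_idle_def idle_clip)

lemma accept_prob_clip: "accept_prob N r \<delta> P \<tau> (clip N s) = accept_prob N r \<delta> P \<tau> s"
  by (simp add: accept_prob_def participant_fraction_def idle_clip)

lemma accept_prob_bounds: "0 \<le> accept_prob N r \<delta> P \<tau> s" "accept_prob N r \<delta> P \<tau> s \<le> 1"
proof -
  have "participant_fraction N P s \<le> 1"
    by (simp add: participant_fraction_def divide_le_eq_1 card_mono finite_idle card_gt_0_iff)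
  then show "accept_prob N r \<delta> P \<tau> s \<le> 1"
    unfolding accept_prob_def by (intro power_le_one) (auto simp: participant_fraction_def)
qed (simp add: accept_prob_def participant_fraction_def)

text \<open>If no non-participant is idle, then either nobody is idle or \<open>q = 1\<close>, and
  the left side is \<open>0\<close>. Otherwise a probability is compared with a count of at least
  one.\<close>

lemma nonparticipant_rate_le_idle:
  "(1 - accept_prob N r \<delta> P \<tau> s) * some_idle N s \<le> real (card (idle N s - P))"
proof (cases "idle N s \<subseteq> P")
  case True
  then have "idle N s \<noteq> {} \<Longrightarrow> participant_fraction N P s = 1"
    by (simp add: participant_fraction_def Int_absorb2 finite_idle)
  then show ?thesis using True by (auto simp: some_idle_def accept_prob_def)
next
  case False
  then have "card (idle N s - P) \<ge> 1"
    by (simp add: Suc_le_eq card_gt_0_iff finite_idle)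
  then show ?thesis using accept_prob_bounds[of N r \<delta> P \<tau> s]
    by (auto simp: some_idle_def)
qed

text \<open>The potential for the drift argument.\<close>

definition remaining_work :: "nat \<Rightarrow> nat set \<Rightarrow> state \<Rightarrow> real" where
  "remaining_work N P s = (\<Sum>w\<in>{..<N} - P. real (s w))"

lemma expectation_remaining_work:
  assumes "\<delta> > 0" "b \<ge> 1" "(\<tau> - r) / \<delta> \<in> \<nat>"
  shows "measure_pmf.expectation (step N b r \<delta> P \<tau> s) (remaining_work N P)
    = remaining_work N P (\<lambda>v. s v - 1)
      + (real b - 1) * ((1 - accept_prob N r \<delta> P \<tau> s) * some_idle N s)"
proof (cases "idle N s = {}")
  case True
  then show ?thesis by (simp add: step_def some_idle_def)
next
  case False
  let ?p = "offer \<delta> \<tau> P (idle N s) r"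
  define C where "C = remaining_work N P (\<lambda>v. s v - 1)"
  \<comment> \<open>Admissibility puts \<open>r\<close> exactly \<open>Z\<close> raises below
    \<open>\<tau>\<close>, the form in which the acceptance probability was computed.\<close>
  obtain Z where Z: "(\<tau> - r) / \<delta> = real Z" using assms(3) by (auto elim: Nats_cases)
  then have num: "num_raises r \<delta> \<tau> = Z" and r: "r = \<tau> - real Z * \<delta>"
    using assms(1) by (auto simp: num_raises_def field_simps)
  have prob: "measure_pmf.prob ?p P = accept_prob N r \<delta> P \<tau> s"
    using prob_offer_participant[OF assms(1) finite_idle False, of \<tau> P Z] num r
    by (simp add: accept_prob_def participant_fraction_def)
  have supp: "set_pmf ?p \<subseteq> idle N s" by (rule set_pmf_offer[OF assms(1) finite_idle False])
  have work: "remaining_work N P ((\<lambda>v. s v - 1)(w := b - 1)) = C + (real b - 1) * indicator (- P) w"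
    if "w \<in> idle N s" for w
  proof -
    \<comment> \<open>The worker \<open>w\<close> is idle, so truncated subtraction leaves its entry
      at \<open>0\<close> and overwriting it amounts to adding \<open>b - 1\<close>.\<close>
    have "remaining_work N P ((\<lambda>v. s v - 1)(w := b - 1))
        = (\<Sum>v\<in>{..<N} - P. real (s v - 1) + (if v = w then real b - 1 else 0))"
      unfolding remaining_work_def using that assms(2) by (intro sum.cong) (auto simp: idle_def)
    also have "\<dots> = C + (real b - 1) * indicator (- P) w"
      using that by (auto simp: sum.distrib C_def remaining_work_def idle_def indicator_def)
    finally show ?thesis .
  qed
  have "measure_pmf.expectation (step N b r \<delta> P \<tau> s) (remaining_work N P)
      = measure_pmf.expectation ?p (\<lambda>w. remaining_work N P ((\<lambda>v. s v - 1)(w := b - 1)))"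
    using False by (simp add: step_def)
  also have "\<dots> = measure_pmf.expectation ?p (\<lambda>w. C + (real b - 1) * indicator (- P) w)"
    by (intro integral_cong_AE) (use supp work in \<open>auto simp: AE_measure_pmf_iff\<close>)
  also have "\<dots> = C + (real b - 1) * measure_pmf.prob ?p (- P)"
    by (subst Bochner_Integration.integral_add) (auto intro!: integrable_measure_pmf_finite finite_subset[OF supp finite_idle])
  also have "measure_pmf.prob ?p (- P) = 1 - measure_pmf.prob ?p P"
    using measure_pmf.prob_compl[of P ?p] by (simp add: Compl_eq_Diff_UNIV)
  finally show ?thesis using False by (simp add: prob C_def some_idle_def)
qed

text \<open>
  One step removes \<open>1\<close> from the entry of every busy non-participant, and the one who accepts, having
  been idle, adds \<open>b - 1\<close>; together this makes \<open>b\<close> per accepted order against one per non-participant.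
\<close>

lemma remaining_work_drift:
  assumes "\<delta> > 0" "b \<ge> 1" "(\<tau> - r) / \<delta> \<in> \<nat>"
  shows "remaining_work N P s + real b * ((1 - accept_prob N r \<delta> P \<tau> s) * some_idle N s)
    \<le> measure_pmf.expectation (step N b r \<delta> P \<tau> s) (remaining_work N P) + real (card ({..<N} - P))"
proof -
  have "remaining_work N P s + real (card (idle N s - P))
      = (\<Sum>w\<in>{..<N} - P. real (s w) + (if s w = 0 then 1 else 0))"
  proof -
    have "idle N s - P = ({..<N} - P) \<inter> {w. s w = 0}" by (auto simp: idle_def)
    then show ?thesis by (simp add: remaining_work_def sum.distrib sum.If_cases)
  qed
  \<comment> \<open>By truncated subtraction both summands are \<open>1\<close> when
    \<open>s w = 0\<close> and \<open>s w\<close> otherwise.\<close>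
  also have "\<dots> = (\<Sum>w\<in>{..<N} - P. real (s w - 1) + 1)"
    by (intro sum.cong) auto
  also have "\<dots> = remaining_work N P (\<lambda>v. s v - 1) + real (card ({..<N} - P))"
    by (simp add: remaining_work_def sum.distrib)
  \<comment> \<open>Of the factor \<open>b\<close>, the part \<open>b - 1\<close> appears in the
    expected new work; the remaining single rate is paid for by the idle non-participants.\<close>
  finally show ?thesis
    using nonparticipant_rate_le_idle[of N r \<delta> P \<tau> s]
    unfolding expectation_remaining_work[OF assms] by (simp add: algebra_simps)
qed

section \<open>Oversupply and the long-run acceptance rates\<close>

text \<open>
  After \<open>k\<close> steps, an entry above \<open>b - k\<close> cannot stem from the initial configuration, and the orders
  of different steps leave different entries.  The entry \<open>b\<close> itself occurs only initially.
\<close>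

definition staggered :: "nat \<Rightarrow> nat \<Rightarrow> nat \<Rightarrow> state \<Rightarrow> bool" where
  "staggered N b k s \<longleftrightarrow> (\<forall>w<N. s w \<le> (if k = 0 then b else b - 1)) \<and>
     (\<forall>v<N. \<forall>w<N. s v = s w \<longrightarrow> 0 < s v \<longrightarrow> b < s v + k \<longrightarrow> v = w)"

text \<open>Distinct entries remain distinct as they count down, and the threshold
  \<open>b - k\<close> drops along with them.\<close>

lemma staggered_step:
  assumes "\<delta> > 0" "staggered N b k s" "s' \<in> set_pmf (step N b r \<delta> P \<tau> s)"
  shows "staggered N b (Suc k) s'"
proof -
  have le: "s w \<le> b" if "w < N" for w
    using assms(2) that le_trans[OF _ diff_le_self, of "s w" b 1]
    unfolding staggered_def by (cases "k = 0") simp_all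
  have old: "v = w" if "v < N" "w < N" "s v - 1 = s w - 1" "0 < s v - 1" "b < (s v - 1) + Suc k" for v w
  proof -
    have "s v = s w" "0 < s v" "b < s v + k" using that by linarith+
    then show ?thesis using assms(2) that(1,2) unfolding staggered_def by blast
  qed
  \<comment> \<open>The fresh entry \<open>b - 1\<close> could only collide with an old entry
    \<open>b\<close>, which requires \<open>k = 0\<close>; but then \<open>b - 1\<close> is not yet
    above the threshold.\<close>
  have new: False if "w < N" "s w - 1 = b - 1" "0 < b - 1" "b < (b - 1) + Suc k" for w
  proof -
    have "k \<noteq> 0" "s w = b" using that by linarith+
    then show ?thesis using assms(2) that(1,3) unfolding staggered_def by fastforce
  qed
  from set_pmf_step[OF assms(1,3)] show ?thesis
  proof (elim disjE conjE bexE)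
    assume "s' = (\<lambda>v. s v - 1)"
    then show ?thesis using le old by (auto simp: staggered_def intro: diff_le_mono)
  next
    fix u assume "u \<in> idle N s" "s' = (\<lambda>v. s v - 1)(u := b - 1)"
    moreover have "v = w" if "v < N" "w < N" "s' v = s' w" "0 < s' v" "b < s' v + Suc k" for v w
      using that old[of v w] new[of v] new[of w] \<open>s' = _\<close> by (cases "v = u"; cases "w = u") auto
    ultimately show ?thesis using le by (auto simp: staggered_def intro: diff_le_mono)
  qed
qed

text \<open>Pigeonhole: once \<open>k \<ge> b\<close>, all positive entries are pairwise distinct
  values in \<open>{1..b}\<close>, too few for \<open>N > b\<close> busy workers.\<close>

lemma staggered_imp_idle:
  assumes "staggered N b k s" "k \<ge> b" "N > b"
  shows "idle N s \<noteq> {}"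
proof
  assume "idle N s = {}"
  then have pos: "0 < s w" if "w < N" for w using that by (auto simp: idle_def)
  have "inj_on s {..<N}"
  proof (rule inj_onI)
    fix v w assume "v \<in> {..<N}" "w \<in> {..<N}" "s v = s w"
    moreover from this have "0 < s v" "b < s v + k" using pos[of v] assms(2) by simp_all
    ultimately show "v = w" using assms(1) unfolding staggered_def by blast
  qed
  moreover have "s w \<le> b" if "w < N" for w
    using assms(1) that le_trans[OF _ diff_le_self, of "s w" b 1]
    unfolding staggered_def by (cases "k = 0") simp_all
  then have "s ` {..<N} \<subseteq> {1..b}" using pos by (auto simp: Suc_le_eq)
  ultimately have "card {..<N} \<le> card {1..b}" by (rule card_inj_on_le) simp
  then show False using assms by simp
qed

lemma expectation_some_idle:
  assumes "\<delta> > 0" "N > b" "\<forall>w<N. s0 w \<le> b" "t \<ge> b"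
  shows "measure_pmf.expectation (state_law N b r \<delta> P \<tau> (clip N s0) t) (some_idle N) = 1"
proof -
  interpret finite_markov_chain "clipped_states N b" "step N b r \<delta> P \<tau>"
    by (rule finite_markov_chain_step[OF assms(1)])
  have "staggered N b k s" if "s \<in> set_pmf (law (clip N s0) k)" for k s
    using that
  proof (induction k arbitrary: s)
    case 0
    then show ?case using assms(3) by (auto simp: law_0 staggered_def clip_def)
  qed (auto simp: law_Suc intro: staggered_step[OF assms(1)])
  then have "AE s in measure_pmf (law (clip N s0) t). some_idle N s = 1"
    using staggered_imp_idle[OF _ assms(4,2)] by (auto simp: AE_measure_pmf_iff some_idle_def)
  then have "measure_pmf.expectation (law (clip N s0) t) (some_idle N)
      = measure_pmf.expectation (law (clip N s0) t) (\<lambda>_. 1)"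
    by (intro integral_cong_AE) auto
  then show ?thesis by simp
qed

text \<open>The two rates add up to \<open>some_idle\<close>, whose expectation is \<open>1\<close>
  from time \<open>b\<close> on. This direction of the equality is what a lower bound on the
  participants' rate takes.\<close>

lemma long_run_average_acceptances_ge_1:
  assumes "\<delta> > 0" "N > b" "\<forall>w<N. s0 w \<le> b"
  shows "long_run_average N b r \<delta> P \<tau> s0 (\<lambda>s. accept_prob N r \<delta> P \<tau> s * some_idle N s)
    + long_run_average N b r \<delta> P \<tau> s0 (\<lambda>s. (1 - accept_prob N r \<delta> P \<tau> s) * some_idle N s) \<ge> 1"
proof -
  interpret finite_markov_chain "clipped_states N b" "step N b r \<delta> P \<tau>"
    by (rule finite_markov_chain_step[OF assms(1)])
  let ?E = "\<lambda>f t. measure_pmf.expectation (law (clip N s0) t) f"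
  define f where "f = (\<lambda>s. accept_prob N r \<delta> P \<tau> s * some_idle N s)"
  define g where "g = (\<lambda>s. (1 - accept_prob N r \<delta> P \<tau> s) * some_idle N s)"
  have clips: "f (clip N s) = f s" "g (clip N s) = g s" for s
    by (simp_all add: f_def g_def some_idle_clip accept_prob_clip)
  have fg: "?E f t + ?E g t = ?E (some_idle N) t" for t
    by (subst Bochner_Integration.integral_add[symmetric])
      (auto intro!: integrable_law clip_in_clipped_states assms Bochner_Integration.integral_cong
        simp: f_def g_def algebra_simps)
  \<comment> \<open>Only the times before \<open>b\<close> can fall short, each by at most one
    order.\<close>
  have lower: "real T - real b \<le> (\<Sum>t<T. ?E f t + ?E g t)" for T
  proof (induction T)
    case (Suc T)
    have "0 \<le> ?E (some_idle N) T" by (intro integral_nonneg_AE) (auto simp: some_idle_def)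
    moreover have "0 \<le> (\<Sum>t<T. ?E f t + ?E g t)"
      unfolding fg by (intro sum_nonneg integral_nonneg_AE) (auto simp: some_idle_def)
    ultimately show ?case
      using Suc expectation_some_idle[OF assms, of T r P \<tau>] by (cases "T \<ge> b") (auto simp: fg)
  qed simp
  \<comment> \<open>Rewriting the quotient as \<open>1 - real b / real T\<close> fails at
    \<open>T = 0\<close>, hence an eventual equality.\<close>
  have "(\<lambda>T. (real T - real b) / real T) \<longlonglongrightarrow> 1"
  proof (rule Lim_transform_eventually)
    show "(\<lambda>T. 1 - real b / real T) \<longlonglongrightarrow> 1"
      using tendsto_diff[OF tendsto_const lim_const_over_n, of 1 "real b"] by simp
    show "\<forall>\<^sub>F T in sequentially. 1 - real b / real T = (real T - real b) / real T"
      using eventually_gt_at_top[of 0] by eventually_elim (simp add: field_simps)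
  qed
  moreover have "(\<lambda>T. (\<Sum>t<T. ?E f t) / real T + (\<Sum>t<T. ?E g t) / real T) \<longlonglongrightarrow>
      long_run_average N b r \<delta> P \<tau> s0 f + long_run_average N b r \<delta> P \<tau> s0 g"
    using assms clips by (intro tendsto_add long_run_average_tendsto)
  moreover have "(real T - real b) / real T \<le> (\<Sum>t<T. ?E f t) / real T + (\<Sum>t<T. ?E g t) / real T" for T
    using divide_right_mono[OF lower[of T], of "real T"]
    by (simp add: sum.distrib add_divide_distrib)
  ultimately show ?thesis unfolding f_def[symmetric] g_def[symmetric]
    by (intro LIMSEQ_le) auto
qed

text \<open>The drift inequality for \<open>remaining_work\<close>, averaged over time; the boundary
  term \<open>C\<close> disappears after division by \<open>T\<close>.\<close>

lemma long_run_average_nonparticipants_le: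
  assumes "\<delta> > 0" "b \<ge> 1" "(\<tau> - r) / \<delta> \<in> \<nat>" "\<forall>w<N. s0 w \<le> b"
  shows "real b * long_run_average N b r \<delta> P \<tau> s0 (\<lambda>s. (1 - accept_prob N r \<delta> P \<tau> s) * some_idle N s)
    \<le> real (card ({..<N} - P))"
proof -
  interpret finite_markov_chain "clipped_states N b" "step N b r \<delta> P \<tau>"
    by (rule finite_markov_chain_step[OF assms(1)])
  let ?E = "\<lambda>f t. measure_pmf.expectation (law (clip N s0) t) f"
  define g where "g = (\<lambda>s. (1 - accept_prob N r \<delta> P \<tau> s) * some_idle N s)"
  let ?M = "real (card ({..<N} - P))"
  define C where "C = ?M * real b"
  have upper: "real b * (\<Sum>t<T. ?E g t) \<le> ?M * real T + C" for T
  proof (rule average_law_le_of_drift)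
    show "clip N s0 \<in> clipped_states N b" using assms(4) by (rule clip_in_clipped_states)
    fix s assume s: "s \<in> clipped_states N b"
    show "remaining_work N P s + real b * g s \<le> markov_op (remaining_work N P) s + ?M"
      using remaining_work_drift[OF assms(1-3), of N P s]
      by (simp add: g_def expectation_eq_markov_op[OF s])
    have "remaining_work N P s \<le> (\<Sum>w\<in>{..<N} - P. real b)"
      unfolding remaining_work_def using s by (intro sum_mono) (auto simp: clipped_states_def)
    then show "0 \<le> remaining_work N P s \<and> remaining_work N P s \<le> C"
      by (simp add: C_def remaining_work_def sum_nonneg)
  qed
  have "(\<lambda>T. real b * ((\<Sum>t<T. ?E g t) / real T)) \<longlonglongrightarrow> real b * long_run_average N b r \<delta> P \<tau> s0 g"
    using assms
    by (intro tendsto_mult_left long_run_average_tendsto)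
      (simp_all add: g_def some_idle_clip accept_prob_clip)
  moreover have "(\<lambda>T. ?M + C / real T) \<longlonglongrightarrow> ?M"
    using tendsto_add[OF tendsto_const lim_const_over_n, of ?M C] by simp
  moreover have "real b * ((\<Sum>t<T. ?E g t) / real T) \<le> ?M + C / real T" if "T \<ge> 1" for T
    using divide_right_mono[OF upper[of T], of "real T"] that
    by (simp add: add_divide_distrib)
  ultimately show ?thesis unfolding g_def[symmetric] by (intro LIMSEQ_le) auto
qed

theorem theorem4:
  fixes N b :: nat and r \<delta> c m n \<alpha> \<tau> :: real and P :: "nat set" and s0 :: state
  assumes "N \<ge> 1" and "b \<ge> 1" and "r > 0" and "\<delta> > 0" and "c \<ge> 0" and "m \<ge> 0" and "n > 0"
    and "P \<subseteq> {..<N}" and "real (card P) = \<alpha> * real N"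
    and "\<forall>w<N. s0 w \<le> b"
    and "r > c * m" and "N > b"
    and "0 < \<alpha>" and "\<alpha> < 1"
    and "\<tau> \<ge> r" and "(\<tau> - r) / \<delta> \<in> \<nat>"
    and "real N / real b <
      1 / (1 - \<alpha>) *
      (1 - \<alpha> * (r + spillover N b r \<delta> P \<tau> s0 - c * m) /
             ((1 - \<alpha>) * (\<tau> - c * m) + \<alpha> * (r - c * m)))"
  shows "benefit N b r \<delta> c m n P s0 \<alpha> \<tau> > 0"
proof -
  define x where "x = long_run_average N b r \<delta> P \<tau> s0 (\<lambda>s. accept_prob N r \<delta> P \<tau> s * some_idle N s)"
  define y where "y = long_run_average N b r \<delta> P \<tau> s0
    (\<lambda>s. (1 - accept_prob N r \<delta> P \<tau> s) * some_idle N s)"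
  define R where "R = spillover N b r \<delta> P \<tau> s0"
  \<comment> \<open>The denominator in the hypothesis is also the coefficient of \<open>y\<close>
    once \<open>x\<close> is replaced by \<open>1 - y\<close>; its positivity allows clearing the
    fraction.\<close>
  define D where "D = (1 - \<alpha>) * (\<tau> - c * m) + \<alpha> * (r - c * m)"
  have "\<tau> - c * m > 0" using assms(11,15) by linarith
  then have D: "D > 0" unfolding D_def using assms(11,13,14) by (intro add_pos_pos mult_pos_pos) auto
  have "real (card ({..<N} - P)) = (1 - \<alpha>) * real N"
    using assms(8,9) card_mono[OF _ assms(8)]
    by (simp add: card_Diff_subset finite_subset of_nat_diff algebra_simps)
  then have "real b * y \<le> (1 - \<alpha>) * real N"
    using long_run_average_nonparticipants_le[OF assms(4,2,16,10), of P] by (simp add: y_def)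
  then have "y \<le> (1 - \<alpha>) * (real N / real b)"
    using assms(2) by (simp add: field_simps)
  also have "\<dots> < 1 - \<alpha> * (r + R - c * m) / D"
    using assms(14,17) by (simp add: R_def D_def field_simps)
  finally have "y * D < D - \<alpha> * (r + R - c * m)"
    using D by (simp add: field_simps)
  moreover have "D - \<alpha> * (r + R - c * m) = (1 - \<alpha>) * (\<tau> - c * m) - \<alpha> * R"
    by (simp add: D_def algebra_simps)
  \<comment> \<open>Here \<open>x + y \<ge> 1\<close> enters, scaled by a nonnegative
    coefficient.\<close>
  moreover have "(1 - \<alpha>) * (\<tau> - c * m) * (1 - y) \<le> (1 - \<alpha>) * (\<tau> - c * m) * x"
    using long_run_average_acceptances_ge_1[OF assms(4,12,10), of r P \<tau>] assms(14) \<open>\<tau> - c * m > 0\<close>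
    by (intro mult_left_mono) (auto simp: x_def y_def)
  ultimately have "\<alpha> * ((r - c * m) * y + R) < (1 - \<alpha>) * ((\<tau> - c * m) * x)"
    by (simp add: D_def algebra_simps)
  \<comment> \<open>Over the common denominator, the sign of the benefit is that of the difference
    just shown to be positive.\<close>
  moreover have "benefit N b r \<delta> c m n P s0 \<alpha> \<tau> = n / (\<alpha> * (1 - \<alpha>) * real N)
      * ((1 - \<alpha>) * ((\<tau> - c * m) * x) - \<alpha> * ((r - c * m) * y + R))"
    unfolding benefit_def utility_participant_def utility_nonparticipant_def
      x_def[symmetric] y_def[symmetric] R_def[symmetric]
    using assms(1,13,14) by (simp add: divide_simps) (simp add: algebra_simps)
  ultimately show ?thesis using assms by simp
qed

end
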